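(* Let $G=([n],E)$ be a directed acyclic graph and let $\Sigma^{\mathrm{trop}}=C^\ast\odot (C^\ast)^T$ for a coefficient matrix $C$ supported on $G$. Then for all $i,j\in[n]$, $$(\Sigma^{\mathrm{trop}})_{ij}=\bigvee_{\tau\in\mathcal{T}(i,j)}\tau(C,\mathrm{Id}),$$ where $\mathcal{T}(i,j)$ is the set of all treks from $i$ to $j$ in $G$ and $\tau(C,\mathrm{Id})=\prod_{k\to l\in\tau}c_{lk}$ is the trek monomial of $\tau$.
   Context: Let $[n]=\{1,\dots,n\}$ and $\mathbb{R}_{\ge}=[0,\infty)$. We work in the max-times semiring $(\mathbb{R}_{\ge},\vee,\odot)$ with $a\vee b=\max(a,b)$ and $a\odot b=ab$. The matrix product is $(A\odot B)_{ij}=\bigvee_{\ell}a_{i\ell}b_{\ell j}$, the matrix maximum $\vee$ is taken entrywise, and $A^{\odot k}$ is the $k$-th power for this product, with $A^{\odot 0}=I_n$ the identity matrix. A coefficient matrix supported on $G=([n],E)$ is a matrix $C=(c_{ij})\in\mathbb{R}_{\ge}^{n\times n}$ of edge weights, where $c_{ij}\ge 0$ is the weight of the edge $j\to i$ and $c_{ij}=0$ if $j\to i\notin E$. Its Kleene star is $C^\ast=\bigvee_{k=0}^{n-1}C^{\odot k}$. A trek $\tau$ from $i$ to $j$ is an alternating sequence of nodes and edges of $G$ of the form $$i\leftarrow i_l\leftarrow\cdots\leftarrow i_1\leftarrow i_0\to j_1\to\cdots\to j_r\to j,$$ that is, a pair of directed paths with a common source $i_0$ (the top of $\tau$), one ending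 at $i$ and the other ending at $j$. Either side may be of length zero (so that $i_0=i$ or $i_0=j$), trivial treks consisting of a single node $i=j$ are allowed, and the two sides may share nodes and edges. In the trek monomial, each edge is counted with multiplicity (an edge occurring on both sides contributes its weight twice), and the empty product is $1$. In general, for a diagonal matrix $\Omega=(\omega_{ij})$, the trek monomial is $\tau(C,\Omega)=\omega_{i_0i_0}\prod_{k\to l\in\tau}c_{lk}$; here $\Omega=\mathrm{Id}$ is the identity matrix. *)

theory Defs
  imports "HOL-Analysis.Finite_Cartesian_Product" "HOL-Analysis.Cartesian_Space" "Graph_Theory.Pair_Digraph"
begin

text \<open>
  The node set $[n]$ is a finite index type \<open>'n\<close>, with $n$ = \<open>CARD('n)\<close>; a digraph on $[n]$ is
  a \<open>'n pair_pre_digraph\<close> whose vertex set is \<open>UNIV\<close>.  The pair \<open>(k, l)\<close> is the edge $k \to l$.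
\<close>

text \<open>
  The maximum of a finite family in the max-times semiring on $[0,\infty)$.  The inserted \<open>0\<close> is the
  neutral element of this maximum: it is the value of the empty family and does not affect
  nonempty families of nonnegative numbers.
\<close>
definition trop_sum :: "('a \<Rightarrow> real) \<Rightarrow> 'a set \<Rightarrow> real"
  where "trop_sum f S = Max (insert 0 (f ` S))"

definition trop_mult :: "real^'n^'n \<Rightarrow> real^'n^'n \<Rightarrow> real^'n^'n"  (infixl \<open>\<odot>\<close> 70)
  where "A \<odot> B = (\<chi> i j. trop_sum (\<lambda>l. A $ i $ l * B $ l $ j) UNIV)"

primrec trop_power :: "real^'n^'n \<Rightarrow> nat \<Rightarrow> real^'n^'n"
  where
    "trop_power A 0 = mat 1"
  | "trop_power A (Suc k) = A \<odot> trop_power A k"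

definition kleene_star :: "real^'n^'n \<Rightarrow> real^'n^'n"
  where "kleene_star C = (\<chi> i j. trop_sum (\<lambda>k. trop_power C k $ i $ j) {0..CARD('n) - 1})"

text \<open>Note the transposed indexing: \<open>C $ i $ j\<close> is the weight of the edge $j \to i$.\<close>
definition coefficient_matrix :: "'n pair_pre_digraph \<Rightarrow> real^'n^'n \<Rightarrow> bool"
  where "coefficient_matrix G C \<longleftrightarrow>
    (\<forall>i j. 0 \<le> C $ i $ j \<and> ((j, i) \<notin> parcs G \<longrightarrow> C $ i $ j = 0))"

text \<open>
  A trek is a triple of its top and the edge lists of its left and right sides, both listed in
  the direction of the edges, that is, starting from the top.
\<close>
type_synonym 'n trek = "'n \<times> ('n \<times> 'n) list \<times> ('n \<times> 'n) list"

definition treks :: "'n pair_pre_digraph \<Rightarrow> 'n \<Rightarrow> 'n \<Rightarrow> 'n trek set"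
  where "treks G i j = {(t, p, q).
    pre_digraph.awalk (with_proj G) t p i \<and> pre_digraph.awalk (with_proj G) t q j}"

definition path_weight :: "real^'n^'n \<Rightarrow> ('n \<times> 'n) list \<Rightarrow> real"
  where "path_weight C p = (\<Prod>(k, l)\<leftarrow>p. C $ l $ k)"

fun trek_monomial :: "real^'n^'n \<Rightarrow> real^'n^'n \<Rightarrow> 'n trek \<Rightarrow> real"
  where "trek_monomial C \<Omega> (t, p, q) = \<Omega> $ t $ t * (path_weight C p * path_weight C q)"

end

theory Submission
  imports Defs
begin

text \<open>
  An entry \<open>(i, t)\<close> of the Kleene star is either \<open>0\<close> or the weight of a walk from \<open>t\<close> to \<open>i\<close>, and
  conversely it bounds all such weights, because walks in an acyclic graph have at most \<open>n - 1\<close>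
  edges.  As multiplication is monotone on nonnegative reals, maximising over pairs of walks with
  common top \<open>t\<close> and then over \<open>t\<close> yields the entry of \<open>\<Sigma>\<close>.
\<close>

lemma trop_sum_upper: "finite S \<Longrightarrow> s \<in> S \<Longrightarrow> f s \<le> trop_sum f S"
  by (simp add: trop_sum_def)

lemma trop_sum_nonneg: "finite S \<Longrightarrow> 0 \<le> trop_sum f S"
  by (simp add: trop_sum_def)

lemma trop_sum_least: "finite S \<Longrightarrow> 0 \<le> x \<Longrightarrow> (\<And>s. s \<in> S \<Longrightarrow> f s \<le> x) \<Longrightarrow> trop_sum f S \<le> x"
  by (auto simp: trop_sum_def)

text \<open>A finite maximum is attained. The first alternative covers the inserted
  \<open>0\<close>.\<close>

lemma trop_sum_cases:
  assumes "finite S"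
  obtains "trop_sum f S = 0" | s where "s \<in> S" "trop_sum f S = f s"
proof -
  have "Max (insert 0 (f ` S)) \<in> insert 0 (f ` S)"
    using assms by (intro Max_in) auto
  then show thesis using that unfolding trop_sum_def by blast
qed

lemma path_weight_simps [simp]:
  "path_weight C [] = 1"
  "path_weight C (p @ q) = path_weight C p * path_weight C q"
  "path_weight C ((k, l) # p) = C $ l $ k * path_weight C p"
  by (simp_all add: path_weight_def)

lemma path_weight_nonneg: "(\<And>i j. 0 \<le> C $ i $ j) \<Longrightarrow> 0 \<le> path_weight C p"
  by (induction p) auto

lemma (in wf_digraph) awalk_append_arc:
  assumes "awalk u p v" "e \<in> arcs G" "tail G e = v"
  shows "awalk u (p @ [e]) (head G e)"
  using awalk_appendI[OF assms(1)] arc_implies_awalk[OF assms(2)] assms(3) by simp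

text \<open>Each walk is one candidate in the iterated maximum. The induction peels off the last
  edge because \<open>trop_power\<close> multiplies by \<open>C\<close> on the left and
  \<open>C $ i $ k\<close> weighs the edge into \<open>i\<close>.\<close>

lemma path_weight_le_trop_power:
  fixes G :: "'n::finite pair_pre_digraph" and C :: "real^'n^'n"
  assumes "wf_digraph (with_proj G)" "coefficient_matrix G C"
    and "pre_digraph.awalk (with_proj G) t p i"
  shows "path_weight C p \<le> trop_power C (length p) $ i $ t"
  using assms(3)
proof (induction p arbitrary: i rule: rev_induct)
  case Nil
  interpret wf_digraph "with_proj G" by fact
  show ?case using Nil by (simp add: awalk_Nil_iff mat_def)
next
  case (snoc e p)
  interpret wf_digraph "with_proj G" by fact
  obtain k where e: "e = (k, i)" and p: "awalk t p k"
    using snoc.prems by (cases e) (auto simp: awalk_simps)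
  have "path_weight C (p @ [e]) = C $ i $ k * path_weight C p"
    by (simp add: e)
  also have "\<dots> \<le> C $ i $ k * trop_power C (length p) $ k $ t"
    using snoc.IH[OF p] assms(2) by (auto simp: coefficient_matrix_def intro: mult_left_mono)
  also have "\<dots> \<le> trop_power C (length (p @ [e])) $ i $ t"
    using trop_sum_upper[of UNIV k "\<lambda>k. C $ i $ k * trop_power C (length p) $ k $ t"]
    by (simp add: trop_mult_def)
  finally show ?case .
qed

text \<open>Following a maximising index through each multiplication traces a walk backwards from
  \<open>i\<close>, unless the entry vanishes.\<close>

lemma trop_power_cases:
  fixes G :: "'n::finite pair_pre_digraph" and C :: "real^'n^'n"
  assumes "pverts G = UNIV" "coefficient_matrix G C"
  shows "trop_power C k $ i $ t = 0 \<or>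
    (\<exists>p. pre_digraph.awalk (with_proj G) t p i \<and> trop_power C k $ i $ t = path_weight C p)"
proof (induction k arbitrary: i)
  interpret wf_digraph "with_proj G" using assms(1) by unfold_locales auto
  case 0
  \<comment> \<open>The empty walk, of weight 1, realises the diagonal entries of the identity; the
    other entries are 0.\<close>
  have "awalk t [] t" using assms(1) by (simp add: awalk_Nil_iff)
  then show ?case by (auto simp: mat_def intro!: exI[of _ "[]"])
next
  interpret wf_digraph "with_proj G" using assms(1) by unfold_locales auto
  case (Suc k)
  have eq: "trop_power C (Suc k) $ i $ t = trop_sum (\<lambda>l. C $ i $ l * trop_power C k $ l $ t) UNIV"
    by (simp add: trop_mult_def)
  show ?case
  proof (cases rule: trop_sum_cases[OF finite_class.finite_UNIV, of "\<lambda>l. C $ i $ l * trop_power C k $ l $ t"])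
    case (2 l)
    show ?thesis
    proof (cases "C $ i $ l * trop_power C k $ l $ t = 0")
      case True
      then show ?thesis using 2 eq by simp
    next
      case False
      then obtain p where p: "awalk t p l" "trop_power C k $ l $ t = path_weight C p"
        using Suc.IH[of l] by auto
      \<comment> \<open>A nonzero product has a nonzero factor \<open>C $ i $ l\<close>, and
        \<open>C\<close> is supported on the edges.\<close>
      have "(l, i) \<in> parcs G" using False assms(2) by (auto simp: coefficient_matrix_def)
      then have "awalk t (p @ [(l, i)]) i"
        using awalk_append_arc[OF p(1), of "(l, i)"] by simp
      moreover have "trop_power C (Suc k) $ i $ t = path_weight C (p @ [(l, i)])"
        using 2 eq p(2) by simp
      ultimately show ?thesis by blast
    qed
  qed (use eq in auto)
qed

text \<open>A repeated vertex would close a cycle, so a walk visits distinct vertices, one more than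
  it has edges.\<close>

lemma awalk_length_less_card:
  fixes G :: "'n::finite pair_pre_digraph"
  assumes "wf_digraph (with_proj G)" "acyclic (parcs G)"
    and "pre_digraph.awalk (with_proj G) u p v"
  shows "length p < CARD('n)"
proof -
  interpret wf_digraph "with_proj G" by fact
  have reach: "w \<in> set (awalk_verts u p) \<Longrightarrow> (u, w) \<in> (parcs G)\<^sup>*" if "awalk u p v" for u w p
    using that
    by (induction p arbitrary: u)
      (auto simp: awalk_simps intro: converse_rtrancl_into_rtrancl)
  have "distinct (awalk_verts u p)"
    using assms(3)
  proof (induction p arbitrary: u)
    case (Cons e p)
    then have e: "e \<in> parcs G" "fst e = u" "awalk (snd e) p v" by (auto simp: awalk_simps)
    have "u \<notin> set (awalk_verts (snd e) p)"
    proof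
      assume "u \<in> set (awalk_verts (snd e) p)"
      then have "(snd e, u) \<in> (parcs G)\<^sup>*" using reach e(3) by blast
      moreover have "(u, snd e) \<in> parcs G" using e by (cases e) auto
      ultimately have "(u, u) \<in> (parcs G)\<^sup>+" by (rule rtrancl_into_trancl2[rotated])
      then show False using assms(2) by (simp add: acyclic_def)
    qed
    then show ?case using Cons.IH[OF e(3)] e(2) by simp
  qed simp
  then have "length (awalk_verts u p) \<le> CARD('n)"
    by (metis card_mono distinct_card finite subset_UNIV)
  then show ?thesis by (simp add: length_awalk_verts)
qed

text \<open>\<open>trop_sum\<close> is built on \<open>Max\<close>, so its bounds require a finite
  index set.\<close>

lemma finite_treks:
  fixes G :: "'n::finite pair_pre_digraph"
  assumes "wf_digraph (with_proj G)" "acyclic (parcs G)"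
  shows "finite (treks G i j)"
proof (rule finite_subset)
  let ?P = "{p :: ('n \<times> 'n) list. set p \<subseteq> UNIV \<and> length p \<le> CARD('n)}"
  show "treks G i j \<subseteq> UNIV \<times> ?P \<times> ?P"
    using awalk_length_less_card[OF assms] by (auto simp: treks_def intro: less_imp_le)
  show "finite ((UNIV :: 'n set) \<times> ?P \<times> ?P)"
    by (intro finite_cartesian_product finite_lists_length_le) auto
qed

lemma kleene_star_nonneg: "0 \<le> kleene_star C $ i $ j"
  by (simp add: kleene_star_def trop_sum_nonneg)

text \<open>Acyclicity places the length of every walk in the range of exponents over which the
  Kleene star is taken.\<close>

lemma path_weight_le_kleene_star:
  fixes G :: "'n::finite pair_pre_digraph"
  assumes "wf_digraph (with_proj G)" "acyclic (parcs G)" "coefficient_matrix G C"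
    and "pre_digraph.awalk (with_proj G) t p i"
  shows "path_weight C p \<le> kleene_star C $ i $ t"
proof -
  have "length p \<in> {0..CARD('n) - 1}"
    using awalk_length_less_card[OF assms(1,2,4)] by simp
  then have "trop_power C (length p) $ i $ t \<le> kleene_star C $ i $ t"
    unfolding kleene_star_def
    using trop_sum_upper[of "{0..CARD('n) - 1}" "length p" "\<lambda>k. trop_power C k $ i $ t"] by simp
  then show ?thesis using path_weight_le_trop_power[OF assms(1,3,4)] by simp
qed

lemma kleene_star_cases:
  fixes G :: "'n::finite pair_pre_digraph"
  assumes "pverts G = UNIV" "coefficient_matrix G C"
  obtains "kleene_star C $ i $ t = 0"
  | p where "pre_digraph.awalk (with_proj G) t p i" "kleene_star C $ i $ t = path_weight C p"
proof -
  have eq: "kleene_star C $ i $ t = trop_sum (\<lambda>k. trop_power C k $ i $ t) {0..CARD('n) - 1}"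
    by (simp add: kleene_star_def)
  have "kleene_star C $ i $ t = 0 \<or> (\<exists>k. kleene_star C $ i $ t = trop_power C k $ i $ t)"
    unfolding eq by (rule trop_sum_cases[OF finite_atLeastAtMost]) auto
  then show thesis
    using that trop_power_cases[OF assms, of _ i t] by fastforce
qed

theorem theorem4p3:
  fixes G :: "'n::finite pair_pre_digraph" and C \<Sigma> :: "real^'n^'n"
  assumes "pverts G = UNIV"
    and "acyclic (parcs G)"
    and "coefficient_matrix G C"
    and "\<Sigma> = kleene_star C \<odot> transpose (kleene_star C)"
  shows "\<forall>i j. \<Sigma> $ i $ j = trop_sum (trek_monomial C (mat 1)) (treks G i j)"
proof (intro allI antisym)
  fix i j
  interpret wf_digraph "with_proj G" using assms(1) by unfold_locales auto
  note wf = wf_digraph_axioms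
  let ?K = "kleene_star C" and ?f = "trek_monomial C (mat 1)"
  have fin: "finite (treks G i j)" by (rule finite_treks[OF wf assms(2)])
  \<comment> \<open>The transpose makes \<open>l\<close> the column index of both factors, hence the
    common source of both walks.\<close>
  have \<Sigma>: "\<Sigma> $ i $ j = trop_sum (\<lambda>l. ?K $ i $ l * ?K $ j $ l) UNIV"
    by (simp add: assms(4) trop_mult_def transpose_def)
  show "\<Sigma> $ i $ j \<le> trop_sum ?f (treks G i j)"
    unfolding \<Sigma>
  proof (rule trop_sum_least)
    fix l
    show "?K $ i $ l * ?K $ j $ l \<le> trop_sum ?f (treks G i j)"
    \<comment> \<open>If a factor is 0, so is the product, and the right side is nonnegative.
      Otherwise the two walks from \<open>l\<close> form a trek with top \<open>l\<close>.\<close>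
    proof (cases rule: kleene_star_cases[OF assms(1,3), of i l])
      case p: (2 p)
      show ?thesis
      proof (cases rule: kleene_star_cases[OF assms(1,3), of j l])
        case q: (2 q)
        have "(l, p, q) \<in> treks G i j" using p q by (simp add: treks_def)
        from trop_sum_upper[OF fin this, of ?f] show ?thesis
          using p q by (simp add: mat_def)
      qed (simp add: trop_sum_nonneg fin)
    qed (simp add: trop_sum_nonneg fin)
  qed (simp_all add: trop_sum_nonneg fin)
  show "trop_sum ?f (treks G i j) \<le> \<Sigma> $ i $ j"
  proof (rule trop_sum_least[OF fin])
    show "0 \<le> \<Sigma> $ i $ j" by (simp add: \<Sigma> trop_sum_nonneg)
    fix \<tau> assume "\<tau> \<in> treks G i j"
    then obtain t p q where \<tau>: "\<tau> = (t, p, q)" "awalk t p i" "awalk t q j"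
      by (auto simp: treks_def)
    \<comment> \<open>The top contributes the factor 1, a diagonal entry of the identity.\<close>
    have "?f \<tau> = path_weight C p * path_weight C q" by (simp add: \<tau> mat_def)
    also have "\<dots> \<le> ?K $ i $ t * ?K $ j $ t"
      using assms(3) \<tau>
      by (intro mult_mono path_weight_le_kleene_star[OF wf assms(2,3)] path_weight_nonneg
          kleene_star_nonneg) (auto simp: coefficient_matrix_def)
    also have "\<dots> \<le> \<Sigma> $ i $ j"
      unfolding \<Sigma> using trop_sum_upper[of UNIV t "\<lambda>l. ?K $ i $ l * ?K $ j $ l"] by simp
    finally show "?f \<tau> \<le> \<Sigma> $ i $ j" .
  qed
qed

end
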